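(* For every composition $\alpha$ and every $s\ge0$, \[ \mathcal{Q}'_\alpha H_s = \sum_{\beta:\ \alpha\subset_s\beta} (1-q)^{n(\alpha,\beta)}\,\mathcal{Q}'_\beta, \] the sum over compositions $\beta$ with $\alpha\subset_s\beta$.
   Context: Work over $\mathbb{Q}(q)$. $\mathrm{NSym}$ is the free associative algebra on $H_1,H_2,\dots$ ($H_0=1$, $H_{-r}=0$ for $r>0$), graded dual to $\mathrm{QSym}$ via $\langle H_{\alpha_1}\cdots H_{\alpha_k},M_\beta\rangle=\delta_{\alpha\beta}$ ($M_\beta$ monomial quasisymmetric functions), coproduct $\Delta(H_j)=\sum_iH_i\otimes H_{j-i}$; $\mathrm{NSym}[q]$ denotes its extension of scalars to $\mathbb{Q}(q)$. For $F\in\mathrm{QSym}$, $F^\perp$ satisfies $\langle F^\perp(H),G\rangle=\langle H,FG\rangle$ (extended linearly). $F_i=\sum_{\gamma\models i}M_\gamma$ ($F_0=1$) and $F_{1^i}=M_{1^i}$ are fundamental quasisymmetric functions. Let $\mathbb{B}_m=\sum_{i\ge0}(-1)^iH_{m+i}F_{1^i}^\perp$ and $\widetilde{\mathbb{B}}_m(f)=\sum_{i\ge0}q^i\,\mathbb{B}_{m+i}(F_i^\perp(f))$ for $m\in\mathbb{Z}$; for $\alpha\in\mathbb{Z}^m$ set $\mathcal{Q}'_\alpha=\widetilde{\mathbb{B}}_{\alpha_1}\cdots\widetilde{\mathbb{B}}_{\alpha_m}(1)$. For compositions, $\alpha\subset_s\beta$ means $|\beta|=|\alpha|+s$, $\alpha_j\le\beta_j$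 for all $j\le\ell(\alpha)$, and $\ell(\beta)\le\ell(\alpha)+1$. $n(\alpha,\beta)=|\{i\le\ell(\alpha):\alpha_i<\beta_i\}|$ is the number of rows of $\alpha$ strictly shorter than the same row of $\beta$. *)

theory Defs
  imports
    "HOL-Library.Poly_Mapping"
    "HOL-Computational_Algebra.Polynomial"
    "HOL-Computational_Algebra.Fraction_Field"
begin

type_synonym qrat = "rat poly fract"

definition q :: qrat
  where "q = Fract [:0, 1:] 1"

section \<open>Compositions\<close>

typedef composition = "{xs :: nat list. 0 \<notin> set xs}"
  morphisms parts Composition
  by (rule exI[of _ "[]"]) simp

lemma parts_pos: "0 \<notin> set (parts \<alpha>)"
  using parts[of \<alpha>] by simp

lemma parts_Composition: "0 \<notin> set xs \<Longrightarrow> parts (Composition xs) = xs"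
  by (simp add: Composition_inverse)

text \<open>Concatenation, written additively so that the monoid algebra of compositions is the
  type \<^typ>\<open>composition \<Rightarrow>\<^sub>0 qrat\<close>.\<close>

instantiation composition :: monoid_add
begin

definition zero_composition :: composition
  where "0 = Composition []"

definition plus_composition :: "composition \<Rightarrow> composition \<Rightarrow> composition"
  where "\<alpha> + \<beta> = Composition (parts \<alpha> @ parts \<beta>)"

instance
  by standard
    (simp_all add: zero_composition_def plus_composition_def parts_Composition parts_pos
      parts_inverse)

end

definition comp_size :: "composition \<Rightarrow> nat"
  where "comp_size \<alpha> = sum_list (parts \<alpha>)"

definition comp_len :: "composition \<Rightarrow> nat"
  where "comp_len \<alpha> = length (parts \<alpha>)"

lemma finite_compositions_le: "finite {\<gamma>. comp_size \<gamma> \<le> n}"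
proof -
  have len: "length xs \<le> sum_list xs" if "0 \<notin> set xs" for xs :: "nat list"
    using that by (induction xs) auto
  have "parts ` {\<gamma>. comp_size \<gamma> \<le> n} \<subseteq> {xs. set xs \<subseteq> {0..n} \<and> length xs \<le> n}"
  proof
    fix xs assume "xs \<in> parts ` {\<gamma>. comp_size \<gamma> \<le> n}"
    then obtain \<gamma> where \<gamma>: "xs = parts \<gamma>" "sum_list (parts \<gamma>) \<le> n"
      by (auto simp: comp_size_def)
    have "length xs \<le> n" using len[OF parts_pos, of \<gamma>] \<gamma> by simp
    moreover have "set xs \<subseteq> {0..n}"
    proof
      fix x assume "x \<in> set xs"
      then have "x \<le> sum_list xs" by (intro member_le_sum_list) auto
      then show "x \<in> {0..n}" using \<gamma> by simp
    qed
    ultimately show "xs \<in> {xs. set xs \<subseteq> {0..n} \<and> length xs \<le> n}" by simp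
  qed
  moreover have "finite {xs. set xs \<subseteq> {0..n} \<and> length xs \<le> n}"
    by (rule finite_lists_length_le) simp
  ultimately have "finite (parts ` {\<gamma>. comp_size \<gamma> \<le> n})"
    by (rule finite_subset)
  then show ?thesis
    by (rule finite_imageD) (simp add: inj_on_def parts_inject)
qed

lemma finite_compositions: "finite {\<gamma>. comp_size \<gamma> = n}"
  by (rule finite_subset[OF _ finite_compositions_le[of n]]) auto

section \<open>Noncommutative symmetric functions over the rational functions\<close>

text \<open>The monoid algebra of the free monoid on the positive integers, that is, the free
  associative algebra on \<open>H\<^sub>1, H\<^sub>2, \<dots>\<close>; the basis element at \<open>\<alpha>\<close> is
  \<open>H\<^bsub>\<alpha>1\<^esub> \<cdots> H\<^bsub>\<alpha>k\<^esub>\<close>.\<close>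

type_synonym nsym = "composition \<Rightarrow>\<^sub>0 qrat"

definition smul :: "qrat \<Rightarrow> nsym \<Rightarrow> nsym"
  where "smul c f = Poly_Mapping.map ((*) c) f"

definition H :: "int \<Rightarrow> nsym"
  where "H j = (if j < 0 then 0 else if j = 0 then 1
                else Poly_Mapping.single (Composition [nat j]) 1)"

definition Hcomp :: "composition \<Rightarrow> nsym"
  where "Hcomp \<alpha> = prod_list (map (\<lambda>a. H (int a)) (parts \<alpha>))"

lemma Hcomp_eq_single: "Hcomp \<alpha> = Poly_Mapping.single \<alpha> 1"
proof -
  have "prod_list (map (\<lambda>a. H (int a)) xs) = Poly_Mapping.single (Composition xs) 1"
    if "0 \<notin> set xs" for xs
    using that
  proof (induction xs)
    case Nil
    then show ?case by (simp flip: zero_composition_def)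
  next
    case (Cons a xs)
    then have "H (int a) = Poly_Mapping.single (Composition [a]) 1"
      by (simp add: H_def)
    then show ?case
      using Cons by (simp add: Poly_Mapping.mult_single plus_composition_def parts_Composition)
  qed
  from this[OF parts_pos] show ?thesis
    by (simp add: Hcomp_def parts_inverse)
qed

section \<open>Quasisymmetric functions\<close>

text \<open>A power series in \<open>x\<^sub>0, x\<^sub>1, \<dots>\<close> is its coefficient function on exponent vectors.\<close>

type_synonym monom = "nat \<Rightarrow>\<^sub>0 nat"
type_synonym series = "monom \<Rightarrow> qrat"

definition series_times :: "series \<Rightarrow> series \<Rightarrow> series"  (infixl \<open>\<odot>\<close> 70)
  where "(F \<odot> G) m = (\<Sum>(a, b) \<in> {(a, b). a + b = m}. F a * G b)"

definition mdegree :: "monom \<Rightarrow> nat"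
  where "mdegree m = (\<Sum>i \<in> Poly_Mapping.keys m. Poly_Mapping.lookup m i)"

text \<open>The nonzero exponents of a monomial, read in increasing order of the variables.\<close>

definition flat :: "monom \<Rightarrow> composition"
  where "flat m = Composition
    (map (Poly_Mapping.lookup m) (sorted_list_of_set (Poly_Mapping.keys m)))"

definition QSym :: "series set"
  where "QSym = {G. (\<exists>d. \<forall>m. G m \<noteq> 0 \<longrightarrow> mdegree m \<le> d) \<and>
                    (\<forall>m m'. flat m = flat m' \<longrightarrow> G m = G m')}"

text \<open>The monomial quasisymmetric function: the sum of all
  \<open>x\<^bsub>i1\<^esub>\<^bsup>\<beta>1\<^esup> \<cdots> x\<^bsub>ik\<^esub>\<^bsup>\<beta>k\<^esup>\<close> with \<open>i1 < \<cdots> < ik\<close>.\<close>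

definition M :: "composition \<Rightarrow> series"
  where "M \<beta> m = (if flat m = \<beta> then 1 else 0)"

definition fund :: "nat \<Rightarrow> series"
  where "fund i m = (\<Sum>\<gamma> \<in> {\<gamma>. comp_size \<gamma> = i}. M \<gamma> m)"

definition fund_ones :: "nat \<Rightarrow> series"
  where "fund_ones i = M (Composition (replicate i 1))"

text \<open>The monomial \<open>x\<^sub>0\<^bsup>\<alpha>1\<^esup> x\<^sub>1\<^bsup>\<alpha>2\<^esup> \<cdots>\<close>.  Its coefficient in a quasisymmetric function
  \<open>G\<close> is the coefficient of \<open>M \<alpha>\<close> in the expansion of \<open>G\<close>.\<close>

definition mon :: "composition \<Rightarrow> monom"
  where "mon \<alpha> = Poly_Mapping.nth (parts \<alpha>)"

text \<open>The bilinear pairing with \<open>\<langle>Hcomp \<alpha>, M \<beta>\<rangle> = \<delta>\<^bsub>\<alpha>\<beta>\<^esub>\<close>; see \<open>pairing_Hcomp_M\<close>.\<close>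

definition pairing :: "nsym \<Rightarrow> series \<Rightarrow> qrat"
  where "pairing h G = (\<Sum>\<alpha> \<in> Poly_Mapping.keys h. Poly_Mapping.lookup h \<alpha> * G (mon \<alpha>))"

text \<open>Existence and uniqueness of the adjoint are \<open>perp_unique\<close> and \<open>pairing_perp\<close> below.\<close>

definition perp :: "series \<Rightarrow> nsym \<Rightarrow> nsym"
  where "perp F h = (THE h'. \<forall>G \<in> QSym. pairing h' G = pairing h (F \<odot> G))"

section \<open>Creation operators\<close>

text \<open>Both sums over \<open>i\<close> have finite support, by \<open>finite_perp_fund\<close> and
  \<open>finite_perp_fund_ones\<close>, so \<open>Sum_any\<close> is the intended sum.\<close>

definition bern :: "int \<Rightarrow> nsym \<Rightarrow> nsym"
  where "bern m f = Sum_any (\<lambda>i. (-1) ^ i * H (m + int i) * perp (fund_ones i) f)"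

definition bern_t :: "int \<Rightarrow> nsym \<Rightarrow> nsym"
  where "bern_t m f = Sum_any (\<lambda>i. smul (q ^ i) (bern (m + int i) (perp (fund i) f)))"

definition Q' :: "int list \<Rightarrow> nsym"
  where "Q' as = foldr bern_t as 1"

section \<open>The index set of the Pieri rule\<close>

text \<open>\<open>comp_len \<alpha> \<le> comp_len \<beta>\<close> is implicit in comparing every row of \<open>\<alpha>\<close> with the same
  row of \<open>\<beta>\<close>; it has to be explicit because \<open>parts \<beta> ! j\<close> is unspecified past the end.\<close>

definition pieri_ext :: "nat \<Rightarrow> composition \<Rightarrow> composition \<Rightarrow> bool"
  where "pieri_ext s \<alpha> \<beta> \<longleftrightarrow>
    comp_size \<beta> = comp_size \<alpha> + s \<and>
    comp_len \<alpha> \<le> comp_len \<beta> \<and> comp_len \<beta> \<le> comp_len \<alpha> + 1 \<and>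
    (\<forall>j < comp_len \<alpha>. parts \<alpha> ! j \<le> parts \<beta> ! j)"

definition n_shorter :: "composition \<Rightarrow> composition \<Rightarrow> nat"
  where "n_shorter \<alpha> \<beta> = card {i. i < comp_len \<alpha> \<and> parts \<alpha> ! i < parts \<beta> ! i}"

lemma finite_pieri_ext: "finite {\<beta>. pieri_ext s \<alpha> \<beta>}"
  by (rule finite_subset[OF _ finite_compositions[of "comp_size \<alpha> + s"]])
    (auto simp: pieri_ext_def)

section \<open>Well-definedness\<close>

lemma lookup_smul: "Poly_Mapping.lookup (smul c f) \<alpha> = c * Poly_Mapping.lookup f \<alpha>"
  by (simp add: smul_def Poly_Mapping.map.rep_eq when_def)

lemma parts_flat:
  "parts (flat m) = map (Poly_Mapping.lookup m) (sorted_list_of_set (Poly_Mapping.keys m))"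
  unfolding flat_def
  by (rule parts_Composition) (auto simp: in_keys_iff)

lemma comp_size_flat: "comp_size (flat m) = mdegree m"
  by (simp add: comp_size_def parts_flat mdegree_def sum_list_distinct_conv_sum_set)

lemma flat_mon: "flat (mon \<alpha>) = \<alpha>"
proof -
  let ?xs = "parts \<alpha>"
  have "Poly_Mapping.keys (mon \<alpha>) = {0..<length ?xs}"
  proof (intro set_eqI)
    fix i
    have "?xs ! i \<noteq> 0" if "i < length ?xs"
      using parts_pos[of \<alpha>] that by (metis nth_mem)
    then show "i \<in> Poly_Mapping.keys (mon \<alpha>) \<longleftrightarrow> i \<in> {0..<length ?xs}"
      by (auto simp: in_keys_iff mon_def nth_default_def simp del: Poly_Mapping.keys_nth)
  qed
  then have "parts (flat (mon \<alpha>)) = map (Poly_Mapping.lookup (mon \<alpha>)) [0..<length ?xs]"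
    by (simp add: parts_flat)
  also have "\<dots> = ?xs"
    by (rule nth_equalityI) (auto simp: mon_def nth_default_def)
  finally show ?thesis
    by (simp add: parts_inject)
qed

lemma mdegree_mon: "mdegree (mon \<alpha>) = comp_size \<alpha>"
  using comp_size_flat[of "mon \<alpha>"] by (simp add: flat_mon)

lemma M_in_QSym: "M \<beta> \<in> QSym"
proof -
  have "M \<beta> m \<noteq> 0 \<longrightarrow> mdegree m \<le> comp_size \<beta>" for m
    by (auto simp: M_def simp flip: comp_size_flat)
  then have "\<exists>d. \<forall>m. M \<beta> m \<noteq> 0 \<longrightarrow> mdegree m \<le> d"
    by blast
  then show ?thesis
    by (simp add: QSym_def) (simp add: M_def)
qed

lemma QSym_flat:
  assumes "G \<in> QSym"
  shows "G m = G (mon (flat m))"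
proof -
  have *: "\<forall>m m'. flat m = flat m' \<longrightarrow> G m = G m'"
    using assms unfolding QSym_def by (elim CollectE conjE)
  show ?thesis
    by (rule *[rule_format]) (simp only: flat_mon)
qed

lemma fund_eq: "fund i m = (if mdegree m = i then 1 else 0)"
  using finite_compositions[of i]
  by (simp add: fund_def M_def comp_size_flat)

lemma pairing_superset:
  assumes "finite A" "Poly_Mapping.keys h \<subseteq> A"
  shows "pairing h G = (\<Sum>\<alpha> \<in> A. Poly_Mapping.lookup h \<alpha> * G (mon \<alpha>))"
  unfolding pairing_def using assms
  by (intro sum.mono_neutral_left) (auto simp: in_keys_iff)

lemma pairing_zero: "pairing 0 G = 0"
  by (simp add: pairing_def)

lemma pairing_add: "pairing (f + g) G = pairing f G + pairing g G"
proof -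
  let ?A = "Poly_Mapping.keys f \<union> Poly_Mapping.keys g"
  have "Poly_Mapping.keys (f + g) \<subseteq> ?A"
    by (rule Poly_Mapping.keys_add)
  then show ?thesis
    by (simp add: pairing_superset[of ?A] lookup_add sum.distrib distrib_right)
qed

lemma pairing_sum: "pairing (sum f A) G = (\<Sum>x \<in> A. pairing (f x) G)"
  by (induction A rule: infinite_finite_induct) (simp_all add: pairing_zero pairing_add)

lemma pairing_single: "pairing (Poly_Mapping.single \<alpha> c) G = c * G (mon \<alpha>)"
  by (simp add: pairing_superset[of "{\<alpha>}"])

lemma pairing_smul: "pairing (smul c f) G = c * pairing f G"
proof -
  have "Poly_Mapping.keys (smul c f) \<subseteq> Poly_Mapping.keys f"
    by (auto simp: in_keys_iff lookup_smul)
  then show ?thesis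
    by (simp add: pairing_superset[of "Poly_Mapping.keys f"] lookup_smul sum_distrib_left mult.assoc)
qed

lemma pairing_M: "pairing h (M \<beta>) = Poly_Mapping.lookup h \<beta>"
proof -
  have "pairing h (M \<beta>) = (\<Sum>\<alpha> \<in> Poly_Mapping.keys h.
      if \<alpha> = \<beta> then Poly_Mapping.lookup h \<alpha> else 0)"
    unfolding pairing_def by (rule sum.cong) (auto simp: M_def flat_mon)
  also have "\<dots> = Poly_Mapping.lookup h \<beta>"
    by (simp add: in_keys_iff)
  finally show ?thesis .
qed

lemma pairing_Hcomp_M: "pairing (Hcomp \<alpha>) (M \<beta>) = (if \<alpha> = \<beta> then 1 else 0)"
  by (auto simp: pairing_M Hcomp_eq_single Poly_Mapping.lookup_single)

lemma finite_splits: "finite {(a, b). a + b = (m :: monom)}"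
proof -
  let ?K = "Poly_Mapping.keys m"
  let ?B = "{g :: nat \<Rightarrow> nat. \<forall>i. (i \<in> ?K \<longrightarrow> g i \<in> {0..mdegree m}) \<and> (i \<notin> ?K \<longrightarrow> g i = 0)}"
  let ?S = "{a :: monom. \<exists>b. a + b = m}"
  have B: "finite ?B"
    by (rule finite_set_of_finite_funs) auto
  have "Poly_Mapping.lookup a \<in> ?B" if ab: "a + b = m" for a b
  proof -
    have le: "Poly_Mapping.lookup a i \<le> Poly_Mapping.lookup m i" for i
      by (simp add: ab[symmetric] lookup_add)
    have "Poly_Mapping.lookup m i \<le> mdegree m" if "i \<in> ?K" for i
      unfolding mdegree_def by (rule member_le_sum[OF that]) auto
    then have "Poly_Mapping.lookup a i \<le> mdegree m" if "i \<in> ?K" for i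
      using le[of i] that order_trans by blast
    moreover have "Poly_Mapping.lookup a i = 0" if "i \<notin> ?K" for i
      using le[of i] that by (simp add: in_keys_iff)
    ultimately show ?thesis by simp
  qed
  then have "Poly_Mapping.lookup ` ?S \<subseteq> ?B" by auto
  then have "finite (Poly_Mapping.lookup ` ?S)"
    using B by (rule finite_subset)
  then have S: "finite ?S"
    by (rule finite_imageD) (simp add: inj_on_def lookup_inject)
  have "{(a, b). a + b = m} \<subseteq> ?S \<times> ?S"
  proof
    fix x assume "x \<in> {(a, b). a + b = m}"
    then obtain a b where x: "x = (a, b)" "a + b = m" by auto
    then have "b + a = m" by (simp add: add.commute)
    with x show "x \<in> ?S \<times> ?S" by blast
  qed
  then show ?thesis
    by (rule finite_subset) (intro finite_cartesian_product S)
qed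

definition perp_basis :: "series \<Rightarrow> composition \<Rightarrow> nsym"
  where "perp_basis F \<alpha> =
    (\<Sum>(a, b) \<in> {(a, b). a + b = mon \<alpha>}. Poly_Mapping.single (flat b) (F a))"

definition perp_explicit :: "series \<Rightarrow> nsym \<Rightarrow> nsym"
  where "perp_explicit F h =
    (\<Sum>\<alpha> \<in> Poly_Mapping.keys h. smul (Poly_Mapping.lookup h \<alpha>) (perp_basis F \<alpha>))"

lemma pairing_perp_basis:
  assumes "G \<in> QSym"
  shows "pairing (perp_basis F \<alpha>) G = (F \<odot> G) (mon \<alpha>)"
  unfolding perp_basis_def series_times_def pairing_sum
  by (rule sum.cong) (auto simp: pairing_single QSym_flat[OF assms, symmetric])

lemma pairing_perp_explicit:
  assumes "G \<in> QSym"
  shows "pairing (perp_explicit F h) G = pairing h (F \<odot> G)"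
  unfolding perp_explicit_def pairing_sum
  by (simp add: pairing_smul pairing_perp_basis[OF assms] pairing_def[of h])

lemma perp_unique:
  assumes "\<forall>G \<in> QSym. pairing h' G = pairing h (F \<odot> G)"
  shows "perp F h = h'"
  unfolding perp_def
proof (rule the_equality[where P = "\<lambda>k. \<forall>G \<in> QSym. pairing k G = pairing h (F \<odot> G)", OF assms])
  fix k assume "\<forall>G \<in> QSym. pairing k G = pairing h (F \<odot> G)"
  then have "pairing k (M \<beta>) = pairing h' (M \<beta>)" for \<beta>
    using assms M_in_QSym by simp
  then show "k = h'"
    by (intro poly_mapping_eqI) (simp add: pairing_M)
qed

lemma perp_eq_explicit: "perp F h = perp_explicit F h"
  by (rule perp_unique) (simp add: pairing_perp_explicit)

lemma pairing_perp:
  assumes "G \<in> QSym"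
  shows "pairing (perp F h) G = pairing h (F \<odot> G)"
  by (simp add: perp_eq_explicit pairing_perp_explicit assms)

lemma mdegree_add: "mdegree (a + b) = mdegree a + mdegree b"
proof -
  have *: "mdegree m = (\<Sum>i \<in> Poly_Mapping.keys a \<union> Poly_Mapping.keys b. Poly_Mapping.lookup m i)"
    if "Poly_Mapping.keys m \<subseteq> Poly_Mapping.keys a \<union> Poly_Mapping.keys b" for m :: monom
    unfolding mdegree_def using that by (intro sum.mono_neutral_left) (auto simp: in_keys_iff)
  show ?thesis
    using Poly_Mapping.keys_add[of a b] by (simp add: * lookup_add sum.distrib)
qed

lemma perp_eq_0:
  assumes F: "\<And>m. F m \<noteq> 0 \<Longrightarrow> mdegree m = i"
    and h: "\<And>\<alpha>. \<alpha> \<in> Poly_Mapping.keys h \<Longrightarrow> comp_size \<alpha> < i"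
  shows "perp F h = 0"
proof -
  have "perp_basis F \<alpha> = 0" if "\<alpha> \<in> Poly_Mapping.keys h" for \<alpha>
    unfolding perp_basis_def
  proof (rule sum.neutral, clarify)
    fix a b assume ab: "a + b = mon \<alpha>"
    have "mdegree a \<le> comp_size \<alpha>"
      by (metis ab le_add1 mdegree_add mdegree_mon)
    then have "F a = 0"
      using F[of a] h[OF that] by fastforce
    then show "Poly_Mapping.single (flat b) (F a) = 0"
      by simp
  qed
  then have "smul (Poly_Mapping.lookup h \<alpha>) (perp_basis F \<alpha>) = 0"
    if "\<alpha> \<in> Poly_Mapping.keys h" for \<alpha>
    using that by (intro poly_mapping_eqI) (simp add: lookup_smul)
  then show ?thesis
    by (simp add: perp_eq_explicit perp_explicit_def)
qed

lemma finite_perp_nonzero: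
  assumes "\<And>i m. F i m \<noteq> 0 \<Longrightarrow> mdegree m = i"
  shows "finite {i. perp (F i) h \<noteq> 0}"
proof -
  let ?N = "Max (insert 0 (comp_size ` Poly_Mapping.keys h))"
  have *: "perp (F i) h = 0" if "?N < i" for i
  proof (rule perp_eq_0[where i = i])
    show "mdegree m = i" if "F i m \<noteq> 0" for m
      by (rule assms[OF that])
    show "comp_size \<alpha> < i" if "\<alpha> \<in> Poly_Mapping.keys h" for \<alpha>
    proof -
      have "comp_size \<alpha> \<le> ?N"
        using that by (intro Max_ge) auto
      then show ?thesis
        using \<open>?N < i\<close> by (rule le_less_trans)
    qed
  qed
  have "{i. perp (F i) h \<noteq> 0} \<subseteq> {..?N}"
  proof
    fix i assume "i \<in> {i. perp (F i) h \<noteq> 0}"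
    then have "\<not> ?N < i" using *[of i] by blast
    then show "i \<in> {..?N}" by (simp only: atMost_iff not_less)
  qed
  then show ?thesis
    by (rule finite_subset) simp
qed

lemma finite_perp_fund: "finite {i. perp (fund i) h \<noteq> 0}"
  by (rule finite_perp_nonzero) (simp add: fund_eq split: if_splits)

lemma finite_perp_fund_ones: "finite {i. perp (fund_ones i) h \<noteq> 0}"
proof (rule finite_perp_nonzero)
  fix i m assume "fund_ones i m \<noteq> 0"
  then have "flat m = Composition (replicate i 1)"
    by (simp add: fund_ones_def M_def split: if_splits)
  then show "mdegree m = i"
    by (simp add: comp_size_def parts_Composition sum_list_replicate flip: comp_size_flat)
qed

end

theory Submission
  imports Defs
begin

text \<open>\<open>F\<^sub>i\<^sup>\<bottom>\<close> and \<open>F\<^bsub>1\<^sup>i\<^esub>\<^sup>\<bottom>\<close> are the components of the algebra homomorphisms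
  \<open>H\<^sub>s \<mapsto> \<Sum>\<^sub>k z\<^sup>k H\<^bsub>s-k\<^esub>\<close> and \<open>H\<^sub>s \<mapsto> H\<^sub>s + z H\<^bsub>s-1\<^esub>\<close>.  Writing \<open>u\<close> for the operator that raises the
  index \<open>m\<close> and lowers the index \<open>s\<close> by one, this makes \<open>bern_t m (f H\<^sub>s)\<close> equal to
  \<open>(1 - u) / (1 - q u)\<close> applied to \<open>bern_t m f \<cdot> H\<^sub>s\<close>.  Inverting,
  \<open>bern_t m f \<cdot> H\<^sub>s = bern_t m (f H\<^sub>s) + (1 - q) \<Sum>\<^bsub>k\<ge>1\<^esub> bern_t (m + k) (f H\<^bsub>s-k\<^esub>)\<close>: the first row
  absorbs \<open>k\<close> boxes, with a factor \<open>1 - q\<close> if \<open>k > 0\<close>, and the remaining ones are passed to the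
  rows below.\<close>

section \<open>Linearity\<close>

text \<open>Identifying scalars with multiples of the empty composition turns linearity facts about
  \<open>smul\<close> into ring laws.\<close>

lemma smul_eq_mult: "smul c f = Poly_Mapping.single 0 c * f"
proof (induction f rule: update_induct)
  case const
  show ?case by (rule poly_mapping_eqI) (simp add: lookup_smul)
next
  case (update f a b)
  have upd: "Poly_Mapping.update a b f = f + Poly_Mapping.single a b"
    using update.hyps by (intro poly_mapping_eqI) (auto simp: lookup_update lookup_add lookup_single in_keys_iff)
  have "smul c (f + Poly_Mapping.single a b) = smul c f + Poly_Mapping.single a (c * b)"
    by (rule poly_mapping_eqI) (simp add: lookup_smul lookup_add lookup_single distrib_left when_def)
  then show ?case
    using update.IH by (simp add: upd distrib_left mult_single)
qed

lemma nsym_decomp: "f = (\<Sum>\<alpha> \<in> Poly_Mapping.keys f. Poly_Mapping.single \<alpha> (Poly_Mapping.lookup f \<alpha>))"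
  by (rule poly_mapping_eqI) (simp add: lookup_sum lookup_single when_def in_keys_iff)

text \<open>Reduces an identity between additive maps to scalar multiples of basis elements; zero is
  itself such a multiple, with coefficient 0.\<close>

lemma nsym_induct [case_names single add]:
  fixes f :: nsym
  assumes "\<And>\<alpha> c. P (Poly_Mapping.single \<alpha> c)" and "\<And>f g. P f \<Longrightarrow> P g \<Longrightarrow> P (f + g)"
  shows "P f"
proof -
  have "P (\<Sum>\<alpha> \<in> A. Poly_Mapping.single \<alpha> (g \<alpha>))" for A g
  proof (induction A rule: infinite_finite_induct)
    case (infinite A)
    then show ?case using assms(1)[of 0 0] by simp
  next
    case empty
    then show ?case using assms(1)[of 0 0] by simp
  next
    case (insert x F)
    then show ?case by (simp add: assms)
  qed
  then show ?thesis
    by (subst nsym_decomp)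
qed

text \<open>Constants are central although the algebra is not commutative: the empty composition is
  neutral and coefficients commute.\<close>

lemma single_zero_commute: "Poly_Mapping.single 0 c * f = f * Poly_Mapping.single 0 (c :: qrat)" for f :: nsym
  by (induction f rule: nsym_induct) (simp_all add: mult_single mult.commute distrib_left distrib_right)

lemma smul_mult_left: "smul c f * g = smul c (f * g)"
  by (simp add: smul_eq_mult mult.assoc)

lemma smul_mult_right: "f * smul c g = smul c (f * g)"
  by (metis smul_eq_mult single_zero_commute mult.assoc)

lemma smul_add: "smul c (f + g) = smul c f + smul c g"
  by (simp add: smul_eq_mult distrib_left)

lemma smul_diff: "smul c (f - g) = smul c f - smul c g"
  by (simp add: smul_eq_mult algebra_simps)

lemma smul_sum: "smul c (sum f A) = (\<Sum>x \<in> A. smul c (f x))"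
  by (simp add: smul_eq_mult sum_distrib_left)

lemma smul_zero [simp]: "smul c 0 = 0"
  by (simp add: smul_eq_mult)

lemma smul_one [simp]: "smul 1 f = f"
  by (rule poly_mapping_eqI) (simp add: lookup_smul)

lemma smul_smul: "smul c (smul d f) = smul (c * d) f"
  by (rule poly_mapping_eqI) (simp add: lookup_smul)

lemma smul_one_minus: "smul (1 - c) f = f - smul c f"
  by (rule poly_mapping_eqI) (simp add: lookup_smul lookup_minus algebra_simps)

section \<open>The adjoint operators: linearity and index zero\<close>

lemma perp_add: "perp F (f + g) = perp F f + perp F g"
  by (rule perp_unique) (simp add: pairing_add pairing_perp)

lemma perp_smul: "perp F (smul c f) = smul c (perp F f)"
  by (rule perp_unique) (simp add: pairing_smul pairing_perp)

lemma perp_zero [simp]: "perp F 0 = 0"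
  by (rule perp_unique) (simp add: pairing_zero)

lemma perp_single: "perp F (Poly_Mapping.single \<alpha> c) = smul c (perp_basis F \<alpha>)"
  by (cases "c = 0") (simp_all add: perp_eq_explicit perp_explicit_def, simp add: smul_eq_mult)

text \<open>Only the trivial splitting of a monomial has a first factor of degree 0.\<close>

lemma perp_fund_0: "perp (fund 0) f = f"
proof (rule perp_unique, intro ballI)
  fix G
  have deg0: "mdegree a = 0 \<longleftrightarrow> a = 0" for a
    by (auto simp: mdegree_def in_keys_iff poly_mapping_eq_iff fun_eq_iff)
  have "(fund 0 \<odot> G) m = G m" for m
  proof -
    have "(fund 0 \<odot> G) m = (\<Sum>(a, b) \<in> {(0, m)}. fund 0 a * G b)"
      unfolding series_times_def
      by (rule sum.mono_neutral_right) (auto simp: finite_splits fund_eq deg0 split: if_split_asm)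
    then show ?thesis by (simp add: fund_eq deg0)
  qed
  then show "pairing f G = pairing f (fund 0 \<odot> G)"
    by (simp add: pairing_def)
qed

lemma fund_ones_0: "fund_ones 0 = fund 0"
proof
  fix m
  have "flat m = Composition [] \<longleftrightarrow> parts (flat m) = []"
    by (simp flip: parts_inject add: parts_Composition)
  also have "\<dots> \<longleftrightarrow> mdegree m = 0"
    using parts_pos[of "flat m"] by (cases "parts (flat m)") (auto simp flip: comp_size_flat simp: comp_size_def)
  finally have "flat m = Composition [] \<longleftrightarrow> mdegree m = 0" .
  then show "fund_ones 0 m = fund 0 m"
    by (simp add: fund_ones_def M_def fund_eq)
qed

section \<open>The adjoint operators on products\<close>

text \<open>Letting \<open>row 0\<close> be the empty composition makes \<open>H (int k)\<close> a
  single basis element for every \<open>k\<close>, including 0.\<close>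

definition row :: "nat \<Rightarrow> composition"
  where "row k = Composition (if k = 0 then [] else [k])"

lemma parts_row: "parts (row k) = (if k = 0 then [] else [k])"
  by (simp add: row_def parts_Composition)

lemma parts_add: "parts (\<alpha> + \<beta>) = parts \<alpha> @ parts \<beta>"
  by (simp add: plus_composition_def parts_Composition parts_pos)

lemma H_row: "H (int k) = Poly_Mapping.single (row k) 1"
  by (auto simp: H_def row_def simp flip: zero_composition_def)

lemma mon_add_row: "mon (\<beta> + row s) = mon \<beta> + Poly_Mapping.single (comp_len \<beta>) s"
  by (rule poly_mapping_eqI)
    (auto simp: mon_def parts_add parts_row lookup_add lookup_single comp_len_def
      nth_default_def nth_append when_def)

lemma keys_mon: "Poly_Mapping.keys (mon \<beta>) \<subseteq> {..<comp_len \<beta>}"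
  by (auto simp: in_keys_iff mon_def comp_len_def nth_default_def simp del: Poly_Mapping.keys_nth
      split: if_splits)

lemma keys_summand:
  assumes "a + b = (m :: monom)"
  shows "Poly_Mapping.keys a \<subseteq> Poly_Mapping.keys m" "Poly_Mapping.keys b \<subseteq> Poly_Mapping.keys m"
  using assms by (auto simp: in_keys_iff lookup_add)

text \<open>The variable \<open>n\<close> comes after every variable of \<open>b\<close>, so its
  exponent is read last; exponent 0 is skipped, matching \<open>row 0\<close>.\<close>

lemma flat_add_last:
  assumes "Poly_Mapping.keys b \<subseteq> {..<n}"
  shows "flat (b + Poly_Mapping.single n k) = flat b + row k"
proof (cases "k = 0")
  case True
  then show ?thesis
    by (simp add: row_def flip: zero_composition_def)
next
  case False
  let ?K = "Poly_Mapping.keys b" and ?b = "b + Poly_Mapping.single n k"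
  have keys: "Poly_Mapping.keys ?b = insert n ?K"
    using False by (auto simp: in_keys_iff lookup_add lookup_single when_def split: if_splits)
  have n: "i < n" if "i \<in> ?K" for i
    using that assms by auto
  then have "n \<notin> ?K" by blast
  have "sorted_list_of_set (insert n ?K) = sorted_list_of_set ?K @ [n]"
    by (rule sorted_list_of_set.sorted_key_list_of_set_unique[THEN iffD1])
      (use n \<open>n \<notin> ?K\<close> in \<open>auto simp: sorted_wrt_append\<close>)
  then have "parts (flat ?b) = parts (flat b) @ [k]"
    using n \<open>n \<notin> ?K\<close> by (auto simp: parts_flat keys lookup_add lookup_single in_keys_iff when_def)
  then have "parts (flat ?b) = parts (flat b + row k)"
    using False by (simp add: parts_add parts_row)
  then show ?thesis by (simp only: parts_inject)
qed

text \<open>The monomial of \<open>\<beta> + row s\<close> is \<open>mon \<beta>\<close> times the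
  \<open>s\<close>-th power of one new last variable. A splitting hands \<open>k\<close> of that
  exponent to the argument of \<open>F\<close>; the remaining \<open>s - k\<close> becomes the right
  factor \<open>H (int (s - k))\<close>.\<close>

lemma perp_basis_add_row:
  "perp_basis F (\<beta> + row s) = (\<Sum>k\<le>s.
     perp_basis (\<lambda>a. F (a + Poly_Mapping.single (comp_len \<beta>) k)) \<beta> * H (int (s - k)))"
proof -
  let ?n = "comp_len \<beta>"
  let ?S = "{(a, b). a + b = mon \<beta>}"
  have zero: "Poly_Mapping.lookup a ?n = 0" "Poly_Mapping.lookup b ?n = 0"
    if "a + b = mon \<beta>" for a b
    using keys_summand[OF that] keys_mon[of \<beta>] by (auto simp: in_keys_iff subset_iff)
  \<comment> \<open>Subtraction of monomials is truncated, but removing the full exponent of a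
    variable loses nothing.\<close>
  have minus: "a - Poly_Mapping.single ?n (Poly_Mapping.lookup a ?n) +
      Poly_Mapping.single ?n (Poly_Mapping.lookup a ?n) = a" for a :: monom
    by (rule poly_mapping_eqI) (simp add: lookup_add lookup_minus lookup_single when_def)
  have "perp_basis F (\<beta> + row s) = (\<Sum>(k, a, b) \<in> {..s} \<times> ?S.
      Poly_Mapping.single (flat (b + Poly_Mapping.single ?n (s - k)))
        (F (a + Poly_Mapping.single ?n k)))"
    unfolding perp_basis_def mon_add_row
  \<comment> \<open>A pair \<open>(a, b)\<close> corresponds to the exponent of the last variable in
    \<open>a\<close> and the pair with that variable deleted from both.\<close>
  proof (rule sum.reindex_bij_witness[where
      j = "\<lambda>(a, b). (Poly_Mapping.lookup a ?n,
        a - Poly_Mapping.single ?n (Poly_Mapping.lookup a ?n),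
        b - Poly_Mapping.single ?n (Poly_Mapping.lookup b ?n))" and
      i = "\<lambda>(k, a, b). (a + Poly_Mapping.single ?n k, b + Poly_Mapping.single ?n (s - k))"], goal_cases)
    case (1 x)
    then obtain a b where x: "x = (a, b)" and ab: "a + b = mon \<beta> + Poly_Mapping.single ?n s"
      by auto
    have "Poly_Mapping.lookup a ?n + Poly_Mapping.lookup b ?n = s"
      using arg_cong[OF ab, of "\<lambda>m. Poly_Mapping.lookup m ?n"] zero[of "mon \<beta>" 0]
      by (simp add: lookup_add lookup_single)
    then have "s - Poly_Mapping.lookup a ?n = Poly_Mapping.lookup b ?n" by simp
    then show ?case by (simp add: x minus)
  next
    case (2 x)
    then obtain a b where x: "x = (a, b)" and ab: "a + b = mon \<beta> + Poly_Mapping.single ?n s"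
      by auto
    have s: "Poly_Mapping.lookup a ?n + Poly_Mapping.lookup b ?n = s"
      using arg_cong[OF ab, of "\<lambda>m. Poly_Mapping.lookup m ?n"] zero[of "mon \<beta>" 0]
      by (simp add: lookup_add lookup_single)
    have "a - Poly_Mapping.single ?n (Poly_Mapping.lookup a ?n) +
        (b - Poly_Mapping.single ?n (Poly_Mapping.lookup b ?n)) = mon \<beta>" (is "?l = _")
    proof (rule poly_mapping_eqI)
      fix i
      show "Poly_Mapping.lookup ?l i = Poly_Mapping.lookup (mon \<beta>) i"
        using arg_cong[OF ab, of "\<lambda>m. Poly_Mapping.lookup m i"] zero[of "mon \<beta>" 0]
        by (cases "i = ?n") (simp_all add: lookup_add lookup_minus lookup_single when_def)
    qed
    then show ?case using s by (auto simp: x)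
  next
    case (3 x)
    then show ?case by (auto simp: lookup_add lookup_single zero)
  next
    case (4 x)
    then obtain k a b where x: "x = (k, a, b)" "k \<le> s" "a + b = mon \<beta>" by auto
    have "a + Poly_Mapping.single ?n k + (b + Poly_Mapping.single ?n (s - k)) =
        a + b + (Poly_Mapping.single ?n k + Poly_Mapping.single ?n (s - k))"
      by (simp add: ac_simps)
    then show ?case using x by (simp flip: single_add)
  next
    case (5 x)
    then obtain a b where x: "x = (a, b)" and ab: "a + b = mon \<beta> + Poly_Mapping.single ?n s"
      by auto
    have "Poly_Mapping.lookup a ?n + Poly_Mapping.lookup b ?n = s"
      using arg_cong[OF ab, of "\<lambda>m. Poly_Mapping.lookup m ?n"] zero[of "mon \<beta>" 0]
      by (simp add: lookup_add lookup_single)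
    then have "s - Poly_Mapping.lookup a ?n = Poly_Mapping.lookup b ?n" by simp
    then show ?case by (simp add: x minus)
  qed
  also have "\<dots> = (\<Sum>(k, a, b) \<in> {..s} \<times> ?S.
      Poly_Mapping.single (flat b) (F (a + Poly_Mapping.single ?n k)) * H (int (s - k)))"
  proof (rule sum.cong[OF refl], clarify)
    fix k a b assume "a + b = mon \<beta>"
    then have "Poly_Mapping.keys b \<subseteq> {..<?n}"
      using keys_summand keys_mon by blast
    then show "Poly_Mapping.single (flat (b + Poly_Mapping.single ?n (s - k)))
        (F (a + Poly_Mapping.single ?n k)) =
      Poly_Mapping.single (flat b) (F (a + Poly_Mapping.single ?n k)) * H (int (s - k))"
      by (simp add: flat_add_last H_row mult_single)
  qed
  also have "\<dots> = (\<Sum>k\<le>s.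
     perp_basis (\<lambda>a. F (a + Poly_Mapping.single (comp_len \<beta>) k)) \<beta> * H (int (s - k)))"
    by (simp add: sum.cartesian_product perp_basis_def sum_distrib_right case_prod_unfold del: of_nat_diff)
  finally show ?thesis .
qed

text \<open>Only factors of \<open>mon \<beta>\<close> are ever fed to \<open>F\<close>, and they
  involve no variable beyond the rows of \<open>\<beta>\<close>.\<close>

lemma perp_basis_cong:
  assumes "\<And>a. Poly_Mapping.keys a \<subseteq> {..<comp_len \<beta>} \<Longrightarrow> F a = G a"
  shows "perp_basis F \<beta> = perp_basis G \<beta>"
proof -
  have "F a = G a" if "a + b = mon \<beta>" for a b
    using assms keys_summand(1)[OF that] keys_mon by blast
  then show ?thesis
    unfolding perp_basis_def by (intro sum.cong) auto
qed

lemma perp_mult_H_induct: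
  assumes "\<And>\<beta>. perp_basis F (\<beta> + row s) = perp_basis F \<beta> * H (int s) + perp_basis G (\<beta> + row t)"
  shows "perp F (f * H (int s)) = perp F f * H (int s) + perp G (f * H (int t))"
  by (induction f rule: nsym_induct)
    (simp_all add: distrib_left distrib_right perp_add H_row mult_single perp_single
      assms smul_add smul_mult_left)

lemma mdegree_single: "mdegree (Poly_Mapping.single n k) = k"
  by (simp add: mdegree_def)

text \<open>\<open>fund i\<close> sees only the degree. In the expansion over the exponent of the
  last variable, lowering each positive exponent by one turns those terms into the expansion for
  \<open>fund i\<close> and \<open>s\<close>.\<close>

lemma perp_fund_Suc_mult_H:
  "perp (fund (Suc i)) (f * H (int (Suc s))) =
    perp (fund (Suc i)) f * H (int (Suc s)) + perp (fund i) (f * H (int s))"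
proof (rule perp_mult_H_induct)
  fix \<beta>
  have "(\<lambda>a. fund (Suc i) (a + Poly_Mapping.single n (Suc k))) =
      (\<lambda>a. fund i (a + Poly_Mapping.single n k))" for n k
    by (simp add: fund_eq mdegree_add mdegree_single)
  then show "perp_basis (fund (Suc i)) (\<beta> + row (Suc s)) =
      perp_basis (fund (Suc i)) \<beta> * H (int (Suc s)) + perp_basis (fund i) (\<beta> + row s)"
    by (simp add: perp_basis_add_row sum.atMost_Suc_shift del: sum.atMost_Suc)
qed

text \<open>\<open>fund_ones\<close> is supported on squarefree monomials, so the last variable
  occurs with exponent 0 or 1, which leaves just two terms.\<close>

lemma perp_fund_ones_Suc_mult_H:
  "perp (fund_ones (Suc i)) (f * H (int (Suc s))) =
    perp (fund_ones (Suc i)) f * H (int (Suc s)) + perp (fund_ones i) f * H (int s)"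
proof -
  have *: "fund_ones (Suc i) (a + Poly_Mapping.single n (Suc k)) = (if k = 0 then fund_ones i a else 0)"
    if "Poly_Mapping.keys a \<subseteq> {..<n}" for a n k
  proof -
    have "flat a + row (Suc k) = Composition (replicate (Suc i) 1) \<longleftrightarrow>
        parts (flat a) @ [Suc k] = replicate i 1 @ [1]"
      by (simp flip: parts_inject add: parts_add parts_row parts_Composition replicate_append_same)
    also have "\<dots> \<longleftrightarrow> k = 0 \<and> flat a = Composition (replicate i 1)"
      by (auto simp flip: parts_inject simp: parts_Composition)
    finally show ?thesis
      using that by (auto simp: fund_ones_def M_def flat_add_last)
  qed
  have zero: "perp_basis (\<lambda>a. 0) \<beta> = 0" for \<beta>
    by (simp add: perp_basis_def case_prod_unfold)
  have "perp_basis (\<lambda>a. fund_ones (Suc i) (a + Poly_Mapping.single (comp_len \<beta>) (Suc k))) \<beta> =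
      (if k = 0 then perp_basis (fund_ones i) \<beta> else 0)" for \<beta> k
    by (rule trans[OF perp_basis_cong[OF *]]) (simp_all add: zero)
  then have "perp_basis (fund_ones (Suc i)) (\<beta> + row (Suc s)) =
      perp_basis (fund_ones (Suc i)) \<beta> * H (int (Suc s)) + perp_basis (fund_ones i) \<beta> * H (int s)" for \<beta>
    by (simp add: perp_basis_add_row sum.atMost_Suc_shift if_distrib[of "\<lambda>x. x * _"]
        del: sum.atMost_Suc cong: if_cong)
  then show ?thesis
    by (induction f rule: nsym_induct)
      (simp_all add: distrib_left distrib_right perp_add H_row mult_single perp_single
        smul_add smul_mult_left del: of_nat_Suc)
qed

section \<open>The creation operators on products\<close>

lemma bern_zero [simp]: "bern m 0 = 0"
  by (simp add: bern_def)

text \<open>The cutoff depends on \<open>f\<close> alone, not on \<open>m\<close>. The form with an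
  eventual quantifier lets several expansions be truncated at one common \<open>n\<close>.\<close>

lemma eventually_bern:
  "\<forall>\<^sub>F n in sequentially. \<forall>m. bern m f = (\<Sum>i<n. (-1) ^ i * H (m + int i) * perp (fund_ones i) f)"
proof -
  obtain N where "{i. perp (fund_ones i) f \<noteq> 0} \<subseteq> {..<N}"
    using finite_nat_bounded[OF finite_perp_fund_ones] by blast
  then have N: "perp (fund_ones i) f = 0" if "i \<ge> N" for i
    using that by force
  show ?thesis
    using eventually_ge_at_top[of N]
  proof eventually_elim
    case (elim n)
    show ?case
      unfolding bern_def using elim by (intro allI Sum_any.expand_superset) (auto simp flip: not_le simp: N)
  qed
qed

lemma eventually_bern_t:
  "\<forall>\<^sub>F n in sequentially. \<forall>m. bern_t m f = (\<Sum>i<n. smul (q ^ i) (bern (m + int i) (perp (fund i) f)))"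
proof -
  obtain N where "{i. perp (fund i) f \<noteq> 0} \<subseteq> {..<N}"
    using finite_nat_bounded[OF finite_perp_fund] by blast
  then have N: "perp (fund i) f = 0" if "i \<ge> N" for i
    using that by force
  show ?thesis
    using eventually_ge_at_top[of N]
  proof eventually_elim
    case (elim n)
    show ?case
      unfolding bern_t_def using elim by (intro allI Sum_any.expand_superset) (auto simp flip: not_le simp: N)
  qed
qed

lemma bern_add: "bern m (f + g) = bern m f + bern m g"
proof -
  \<comment> \<open>The claim does not mention \<open>n\<close>: the filter merely supplies one
    \<open>n\<close> at which all three truncations hold.\<close>
  have "\<forall>\<^sub>F n in sequentially. bern m (f + g) = bern m f + bern m g"
    using eventually_bern[of f] eventually_bern[of g] eventually_bern[of "f + g"]
    by eventually_elim (simp add: perp_add distrib_left sum.distrib)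
  then show ?thesis by simp
qed

lemma bern_smul: "bern m (smul c f) = smul c (bern m f)"
proof -
  have "\<forall>\<^sub>F n in sequentially. bern m (smul c f) = smul c (bern m f)"
    using eventually_bern[of f] eventually_bern[of "smul c f"]
    by eventually_elim (simp add: perp_smul smul_mult_right smul_sum)
  then show ?thesis by simp
qed

lemma bern_t_add: "bern_t m (f + g) = bern_t m f + bern_t m g"
proof -
  have "\<forall>\<^sub>F n in sequentially. bern_t m (f + g) = bern_t m f + bern_t m g"
    using eventually_bern_t[of f] eventually_bern_t[of g] eventually_bern_t[of "f + g"]
    by eventually_elim (simp add: perp_add bern_add smul_add sum.distrib)
  then show ?thesis by simp
qed

lemma bern_t_smul: "bern_t m (smul c f) = smul c (bern_t m f)"
proof -
  have "\<forall>\<^sub>F n in sequentially. bern_t m (smul c f) = smul c (bern_t m f)"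
    using eventually_bern_t[of f] eventually_bern_t[of "smul c f"]
    by eventually_elim (simp add: perp_smul bern_smul smul_sum smul_smul mult.commute)
  then show ?thesis by simp
qed

lemma bern_t_zero [simp]: "bern_t m 0 = 0"
  by (simp add: bern_t_def)

lemma bern_t_sum: "bern_t m (sum f A) = (\<Sum>x \<in> A. bern_t m (f x))"
  by (induction A rule: infinite_finite_induct) (simp_all add: bern_t_add)

text \<open>This is the factor \<open>1 - u\<close>: in the extra term of
  \<open>perp_fund_ones_Suc_mult_H\<close>, the shift from \<open>i\<close> to \<open>Suc i\<close>
  flips the sign and raises \<open>m\<close> by one.\<close>

lemma bern_mult_H:
  "bern m (f * H (int (Suc s))) = bern m f * H (int (Suc s)) - bern (m + 1) f * H (int s)"
proof -
  let ?g = "f * H (int (Suc s))"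
  have "\<forall>\<^sub>F n in sequentially.
      bern m ?g = bern m f * H (int (Suc s)) - bern (m + 1) f * H (int s)"
    \<comment> \<open>\<open>eventually_all_ge_at_top\<close> gives the truncations at both
      \<open>n\<close> and \<open>Suc n\<close>; splitting off the term \<open>i = 0\<close> leaves
      a sum one term shorter.\<close>
    using eventually_bern[of f, THEN eventually_all_ge_at_top]
      eventually_bern[of ?g, THEN eventually_all_ge_at_top]
  proof eventually_elim
    case (elim n)
    have f: "bern m f = H m * f +
        (\<Sum>i<n. (-1) ^ Suc i * H (m + int (Suc i)) * perp (fund_ones (Suc i)) f)"
      using elim(1)[THEN spec, of "Suc n"]
      by (simp add: sum.lessThan_Suc_shift fund_ones_0 perp_fund_0 del: sum.lessThan_Suc)
    have f1: "bern (m + 1) f = (\<Sum>i<n. (-1) ^ i * H (m + int (Suc i)) * perp (fund_ones i) f)"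
      using elim(1)[THEN spec, of n] by (simp add: ac_simps)
    have "bern m ?g = H m * ?g +
        (\<Sum>i<n. (-1) ^ Suc i * H (m + int (Suc i)) * perp (fund_ones (Suc i)) ?g)"
      using elim(2)[THEN spec, of "Suc n"]
      by (simp add: sum.lessThan_Suc_shift fund_ones_0 perp_fund_0
          del: sum.lessThan_Suc of_nat_Suc)
    also have "\<dots> = bern m f * H (int (Suc s)) - bern (m + 1) f * H (int s)"
      unfolding f f1 perp_fund_ones_Suc_mult_H
      by (simp add: algebra_simps sum_subtractf sum_distrib_right sum_negf
          del: of_nat_Suc)
    finally show ?case .
  qed
  then show ?thesis by simp
qed

text \<open>The denominator \<open>1 - q u\<close> is cleared here: the recurrence for
  \<open>perp (fund i)\<close> yields the term with \<open>q\<close>, and \<open>bern_mult_H\<close>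
  yields the other shifted term.\<close>

lemma bern_t_mult_H_Suc:
  "bern_t m f * H (int (Suc s)) = bern_t m (f * H (int (Suc s))) -
    smul q (bern_t (m + 1) (f * H (int s))) + bern_t (m + 1) f * H (int s)"
proof -
  let ?g = "f * H (int (Suc s))" and ?h = "f * H (int s)"
  have "\<forall>\<^sub>F n in sequentially. bern_t m ?g = bern_t m f * H (int (Suc s)) -
      bern_t (m + 1) f * H (int s) + smul q (bern_t (m + 1) ?h)"
    using eventually_bern_t[of f, THEN eventually_all_ge_at_top]
      eventually_bern_t[of ?h, THEN eventually_all_ge_at_top]
      eventually_bern_t[of ?g, THEN eventually_all_ge_at_top]
  proof eventually_elim
    case (elim n)
    let ?P = "\<lambda>i. perp (fund i) f"
    have h: "smul q (bern_t (m + 1) ?h) =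
        (\<Sum>i<n. smul (q ^ Suc i) (bern (m + int (Suc i)) (perp (fund i) ?h)))"
      using elim(2)[THEN spec, of n] by (simp add: smul_sum smul_smul ac_simps)
    have "bern_t m ?g = bern m ?g +
        (\<Sum>i<n. smul (q ^ Suc i) (bern (m + int (Suc i)) (perp (fund (Suc i)) ?g)))"
      using elim(3)[THEN spec, of "Suc n"]
      by (simp add: sum.lessThan_Suc_shift perp_fund_0 del: sum.lessThan_Suc of_nat_Suc power_Suc)
    \<comment> \<open>Each term splits in two by the recurrence; the second halves add up to
      \<open>smul q (bern_t (m + 1) ?h)\<close>.\<close>
    also have "\<dots> = bern m ?g +
        (\<Sum>i<n. smul (q ^ Suc i) (bern (m + int (Suc i)) (?P (Suc i) * H (int (Suc s))))) +
        smul q (bern_t (m + 1) ?h)"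
      unfolding h perp_fund_Suc_mult_H by (simp add: bern_add smul_add sum.distrib add.assoc)
    also have "\<dots> = (\<Sum>i<Suc n. smul (q ^ i) (bern (m + int i) (?P i * H (int (Suc s))))) +
        smul q (bern_t (m + 1) ?h)"
      by (simp add: sum.lessThan_Suc_shift perp_fund_0 del: sum.lessThan_Suc of_nat_Suc power_Suc)
    also have "(\<Sum>i<Suc n. smul (q ^ i) (bern (m + int i) (?P i * H (int (Suc s))))) =
        (\<Sum>i<Suc n. smul (q ^ i) (bern (m + int i) (?P i))) * H (int (Suc s)) -
        (\<Sum>i<Suc n. smul (q ^ i) (bern (m + 1 + int i) (?P i))) * H (int s)"
      unfolding bern_mult_H
      by (simp add: smul_diff sum_subtractf sum_distrib_right smul_mult_left ac_simps
          del: sum.lessThan_Suc of_nat_Suc)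
    also have "\<dots> = bern_t m f * H (int (Suc s)) - bern_t (m + 1) f * H (int s)"
      using elim(1)[THEN spec, of "Suc n"] by simp
    finally show ?case .
  qed
  then show ?thesis by simp
qed

lemma H_zero [simp]: "H 0 = 1"
  by (simp add: H_def)

text \<open>Iterates \<open>bern_t_mult_H_Suc\<close>, whose last summand is the same product with
  \<open>m + 1\<close> and a smaller \<open>s\<close>; hence the induction with \<open>m\<close>
  arbitrary.\<close>

lemma bern_t_mult_H:
  "bern_t m f * H (int s) =
    (\<Sum>k\<le>s. smul (if k = 0 then 1 else 1 - q) (bern_t (m + int k) (f * H (int (s - k)))))"
proof (induction s arbitrary: m)
  case 0
  show ?case by simp
next
  case (Suc s)
  let ?c = "\<lambda>k :: nat. if k = 0 then 1 else 1 - q"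
  let ?b = "\<lambda>k. bern_t (m + int (Suc k)) (f * H (int (s - k)))"
  \<comment> \<open>The excess \<open>smul q (?b 0)\<close> at \<open>k = 0\<close> cancels the
    subtracted term of the recurrence, so every shifted coefficient is \<open>1 - q\<close>.\<close>
  have "smul (?c k) (?b k) = smul (1 - q) (?b k) + (if k = 0 then smul q (?b 0) else 0)" for k
    by (simp add: smul_one_minus)
  then have "(\<Sum>k\<le>s. smul (?c k) (?b k)) = (\<Sum>k\<le>s. smul (1 - q) (?b k)) + smul q (?b 0)"
    by (simp add: sum.distrib del: of_nat_Suc of_nat_diff)
  then show ?case
    unfolding bern_t_mult_H_Suc Suc
    by (simp add: sum.atMost_Suc_shift ac_simps del: sum.atMost_Suc)
qed

text \<open>Adjoints of positive degree annihilate 1, so both sums reduce to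
  \<open>i = 0\<close>.\<close>

lemma bern_t_one: "bern_t (int s) 1 = H (int s)"
proof -
  have *: "perp (F i) 1 = 0" if "i > 0" "\<And>m. F i m \<noteq> 0 \<Longrightarrow> mdegree m = i" for F and i :: nat
    using that by (intro perp_eq_0[where i = i])
      (auto simp: comp_size_def zero_composition_def parts_Composition)
  have "perp (fund_ones i) 1 = (if i = 0 then 1 else 0)" for i
  proof (cases "i = 0")
    case False
    then show ?thesis
      by (intro trans[OF *])
       (auto simp: fund_ones_def M_def comp_size_def parts_Composition sum_list_replicate
         simp flip: comp_size_flat split: if_splits)
  qed (simp add: fund_ones_0 perp_fund_0)
  then have bern: "bern m 1 = H m" for m
    by (simp add: bern_def if_distrib[of "\<lambda>x. _ * x"] Sum_any.expand_superset[of "{0}"] cong: if_cong)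
  have "perp (fund i) 1 = (if i = 0 then 1 else 0)" for i
    by (cases "i = 0") (auto simp: perp_fund_0 fund_eq intro!: * split: if_splits)
  then have "smul (q ^ i) (bern (int s + int i) (perp (fund i) 1)) = (if i = 0 then H (int s) else 0)" for i
    by (simp add: bern)
  then show ?thesis
    by (simp add: bern_t_def Sum_any.expand_superset[of "{0}"])
qed

section \<open>The Pieri rule\<close>

lemma parts_row_add: "a > 0 \<Longrightarrow> parts (row a + \<beta>) = a # parts \<beta>"
  by (simp add: parts_add parts_row)

text \<open>Of the \<open>s\<close> added boxes, \<open>k\<close> go to the first row and
  \<open>s - k\<close> to the tail. A new row can appear only at the bottom, so it belongs to the
  tail.\<close>

lemma pieri_ext_row_add:
  assumes "a > 0"
  shows "{\<gamma>. pieri_ext s (row a + \<alpha>) \<gamma>} =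
    (\<lambda>(k, \<beta>). row (a + k) + \<beta>) ` (SIGMA k:{..s}. {\<beta>. pieri_ext (s - k) \<alpha> \<beta>})"
proof (intro set_eqI iffI)
  fix \<gamma> assume "\<gamma> \<in> {\<gamma>. pieri_ext s (row a + \<alpha>) \<gamma>}"
  then have ext: "pieri_ext s (row a + \<alpha>) \<gamma>" by simp
  then obtain c cs where c: "parts \<gamma> = c # cs"
    using assms by (cases "parts \<gamma>") (auto simp: pieri_ext_def comp_len_def parts_row_add)
  define \<beta> where "\<beta> = Composition cs"
  have cs: "parts \<beta> = cs"
    unfolding \<beta>_def using parts_pos[of \<gamma>] c by (intro parts_Composition) simp
  have le: "\<forall>j < Suc (length (parts \<alpha>)). (a # parts \<alpha>) ! j \<le> (c # cs) ! j"
    using ext assms by (simp add: pieri_ext_def comp_len_def parts_row_add c)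
  have "a \<le> c" using le by force
  have le': "\<forall>j < length (parts \<alpha>). parts \<alpha> ! j \<le> cs ! j" using le by force
  have len: "length (parts \<alpha>) \<le> length cs" "length cs \<le> Suc (length (parts \<alpha>))"
    using ext assms by (simp_all add: pieri_ext_def comp_len_def parts_row_add c)
  \<comment> \<open>Comparing sizes row by row shows \<open>c - a \<le> s\<close>, so the
    subtraction \<open>s - (c - a)\<close> is not truncated.\<close>
  have "sum_list (parts \<alpha>) = (\<Sum>j<length (parts \<alpha>). parts \<alpha> ! j)"
    by (simp add: sum_list_sum_nth atLeast0LessThan)
  also have "\<dots> \<le> (\<Sum>j<length (parts \<alpha>). cs ! j)"
    using le' by (intro sum_mono) simp
  also have "\<dots> \<le> (\<Sum>j<length cs. cs ! j)"
    using len by (intro sum_mono2) auto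
  also have "\<dots> = sum_list cs"
    by (simp add: sum_list_sum_nth atLeast0LessThan)
  finally have sum_le: "sum_list (parts \<alpha>) \<le> sum_list cs" .
  have size: "c + sum_list cs = a + sum_list (parts \<alpha>) + s"
    using ext assms by (simp add: pieri_ext_def comp_size_def parts_row_add c)
  have "pieri_ext (s - (c - a)) \<alpha> \<beta>"
    using le' len size sum_le \<open>a \<le> c\<close> by (simp add: pieri_ext_def comp_size_def comp_len_def cs)
  moreover have "\<gamma> = row (a + (c - a)) + \<beta>"
    using \<open>a \<le> c\<close> assms by (simp flip: parts_inject add: parts_row_add c cs)
  ultimately show "\<gamma> \<in> (\<lambda>(k, \<beta>). row (a + k) + \<beta>) ` (SIGMA k:{..s}. {\<beta>. pieri_ext (s - k) \<alpha> \<beta>})"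
    using size sum_le by (intro image_eqI[of _ _ "(c - a, \<beta>)"]) auto
next
  fix \<gamma> assume "\<gamma> \<in> (\<lambda>(k, \<beta>). row (a + k) + \<beta>) ` (SIGMA k:{..s}. {\<beta>. pieri_ext (s - k) \<alpha> \<beta>})"
  then show "\<gamma> \<in> {\<gamma>. pieri_ext s (row a + \<alpha>) \<gamma>}"
    using assms by (auto simp: pieri_ext_def comp_size_def comp_len_def parts_row_add nth_Cons
        split: nat.split)
qed

text \<open>Matches the coefficient in \<open>bern_t_mult_H\<close>: the first row contributes a
  factor \<open>1 - q\<close> exactly when \<open>k > 0\<close>.\<close>

lemma n_shorter_row_add:
  assumes "a > 0"
  shows "n_shorter (row a + \<alpha>) (row (a + k) + \<beta>) = (if k = 0 then 0 else 1) + n_shorter \<alpha> \<beta>"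
proof -
  let ?S = "{i. i < comp_len \<alpha> \<and> parts \<alpha> ! i < parts \<beta> ! i}"
  have "{i. i < comp_len (row a + \<alpha>) \<and> parts (row a + \<alpha>) ! i < parts (row (a + k) + \<beta>) ! i} =
      (if k = 0 then {} else {0}) \<union> Suc ` ?S" (is "?L = ?R")
  proof (rule set_eqI)
    fix i show "i \<in> ?L \<longleftrightarrow> i \<in> ?R"
      using assms by (cases i) (auto simp: comp_len_def parts_row_add)
  qed
  then show ?thesis
    by (simp add: n_shorter_def card_image)
qed

text \<open>There is no row to extend and one new row is allowed, so it takes all \<open>s\<close>
  boxes; \<open>row 0\<close> covers the case \<open>s = 0\<close>.\<close>

lemma pieri_ext_zero: "{\<beta>. pieri_ext s 0 \<beta>} = {row s}"
proof (intro set_eqI iffI)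
  fix \<beta> assume "\<beta> \<in> {\<beta>. pieri_ext s 0 \<beta>}"
  then have "sum_list (parts \<beta>) = s" "length (parts \<beta>) \<le> 1"
    by (simp_all add: pieri_ext_def comp_size_def comp_len_def zero_composition_def parts_Composition)
  then have "parts \<beta> = parts (row s)"
    using parts_pos[of \<beta>] by (cases "parts \<beta>") (auto simp: parts_row)
  then show "\<beta> \<in> {row s}" by (simp add: parts_inject)
next
  fix \<beta> assume "\<beta> \<in> {row s}"
  then show "\<beta> \<in> {\<beta>. pieri_ext s 0 \<beta>}"
    by (simp add: pieri_ext_def comp_size_def comp_len_def zero_composition_def parts_Composition parts_row)
qed

text \<open>Rows are added on the left because the operator of the first row is applied last in
  \<open>Q'\<close>.\<close>

lemma composition_induct [case_names zero add]:
  assumes "P 0" and "\<And>a \<alpha>. a > 0 \<Longrightarrow> P \<alpha> \<Longrightarrow> P (row a + \<alpha>)"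
  shows "P \<alpha>"
proof -
  have "P (Composition xs)" if "0 \<notin> set xs" for xs
    using that
  proof (induction xs)
    case Nil
    then show ?case using assms(1) by (simp add: zero_composition_def)
  next
    case (Cons a xs)
    then have "Composition (a # xs) = row a + Composition xs"
      by (simp add: plus_composition_def parts_row parts_Composition)
    then show ?case using Cons assms(2) by simp
  qed
  from this[OF parts_pos] show ?thesis by (simp add: parts_inverse)
qed

theorem theorem4p8:
  fixes \<alpha> :: composition and s :: nat
  shows "Q' (map int (parts \<alpha>)) * H (int s) =
    (\<Sum>\<beta> \<in> {\<beta>. pieri_ext s \<alpha> \<beta>}.
       smul ((1 - q) ^ n_shorter \<alpha> \<beta>) (Q' (map int (parts \<beta>))))"
proof (induction \<alpha> arbitrary: s rule: composition_induct)
  case zero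
  have "Q' (map int (parts (row s))) = H (int s)"
    by (simp add: Q'_def parts_row bern_t_one)
  moreover have "parts 0 = []"
    by (simp add: zero_composition_def parts_Composition)
  moreover have "n_shorter 0 \<beta> = 0" for \<beta>
    by (simp add: n_shorter_def comp_len_def \<open>parts 0 = []\<close>)
  ultimately show ?case
    by (simp add: pieri_ext_zero) (simp add: Q'_def)
next
  case (add a \<alpha>)
  let ?Q = "\<lambda>\<beta>. Q' (map int (parts \<beta>))"
  have Q: "?Q (row c + \<beta>) = bern_t (int c) (?Q \<beta>)" if "c > 0" for c \<beta>
    using that by (simp add: parts_row_add Q'_def)
  let ?S = "SIGMA k:{..s}. {\<beta>. pieri_ext (s - k) \<alpha> \<beta>}"
  have inj: "inj_on (\<lambda>(k, \<beta>). row (a + k) + \<beta>) ?S"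
  proof (rule inj_onI, clarify)
    fix k k' \<beta> \<beta>'
    assume "row (a + k) + \<beta> = row (a + k') + \<beta>'"
    from arg_cong[OF this, of parts] show "k = k' \<and> \<beta> = \<beta>'"
      using add.hyps by (simp add: parts_row_add parts_inject)
  qed
  have "?Q (row a + \<alpha>) * H (int s) =
      (\<Sum>k\<le>s. smul (if k = 0 then 1 else 1 - q) (bern_t (int (a + k)) (?Q \<alpha> * H (int (s - k)))))"
    using add.hyps by (simp add: Q bern_t_mult_H)
  \<comment> \<open>The induction hypothesis is used for every \<open>s - k\<close>, which is why
    \<open>s\<close> is kept arbitrary.\<close>
  also have "\<dots> = (\<Sum>k\<le>s. \<Sum>\<beta> \<in> {\<beta>. pieri_ext (s - k) \<alpha> \<beta>}.
      smul ((1 - q) ^ n_shorter (row a + \<alpha>) (row (a + k) + \<beta>))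
        (?Q (row (a + k) + \<beta>)))"
    using add.hyps
    by (intro sum.cong refl)
      (simp add: add.IH bern_t_sum bern_t_smul smul_sum smul_smul n_shorter_row_add Q power_add
        del: of_nat_diff)
  also have "\<dots> = (\<Sum>\<gamma> \<in> {\<gamma>. pieri_ext s (row a + \<alpha>) \<gamma>}.
      smul ((1 - q) ^ n_shorter (row a + \<alpha>) \<gamma>) (?Q \<gamma>))"
    unfolding pieri_ext_row_add[OF add.hyps] sum.reindex[OF inj]
    by (simp add: sum.Sigma finite_pieri_ext case_prod_unfold)
  finally show ?case .
qed

end
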